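(* Let $\sigma>0$, $\alpha,\beta\in\mathbb C\setminus\{0\}$, $\lambda=\alpha+\beta$, $\eta=\alpha\beta$, and let $(p_n(z))_{n=0}^\infty$ be the monic polynomial sequence with $p_0=1$ satisfying $$zp_n(z)=p_{n+1}(z)+(\lambda n+\sigma/\alpha)p_n(z)+(\sigma n+\eta n(n-1))p_{n-1}(z),\qquad n\in\mathbb N_0.$$ Then, for all $n\in\mathbb N$, $$z^n=\sum_{k=1}^n(\alpha-\beta)^{n-k}S(n,k)\,(\sigma/\alpha\mid-\beta)_k+\sum_{i=1}^n\Big(\sum_{k=i}^n(\alpha-\beta)^{n-k}S(n,k)\,S(k,i;-\beta,\sigma/\alpha)\Big)p_i(z)$$ and $$p_n(z)=(-\sigma/\alpha\mid\beta)_n+\sum_{i=1}^n\Big(\sum_{k=i}^nS(n,k;\beta,-\sigma/\alpha)\,(\alpha-\beta)^{k-i}s(k,i)\Big)z^i.$$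
   Context: For $z,h\in\mathbb C$: $(z\mid h)_0=1$, $(z\mid h)_n=z(z-h)(z-2h)\cdots(z-(n-1)h)$; $(z)_n=(z\mid1)_n$. Stirling numbers of the first kind $s(n,k)$ (signed) and of the second kind $S(n,k)$ are defined by $(z)_n=\sum_{k=1}^ns(n,k)z^k$ and $z^n=\sum_{k=1}^nS(n,k)(z)_k$. For $h,r\in\mathbb C$ and $0\le k\le n$, the generalized Stirling numbers $S(n,k;h,r)$ are defined by $(z+r\mid h)_n=\sum_{k=0}^nS(n,k;h,r)(z\mid-h)_k$. Convention $0^0=1$ (relevant when $\alpha=\beta$). $\mathbb N=\{1,2,\dots\}$, $\mathbb N_0=\{0,1,2,\dots\}$. *)

theory Defs
  imports
    "HOL-Computational_Algebra.Polynomial"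
    "HOL-Combinatorics.Stirling"
    Complex_Main
begin

text \<open>The generalized falling factorial \<open>(z | h)\<^sub>n = z (z - h) \<dots> (z - (n - 1) h)\<close>.\<close>

definition gfall :: "'a::comm_ring_1 \<Rightarrow> 'a \<Rightarrow> nat \<Rightarrow> 'a" where
  "gfall z h n = (\<Prod>j<n. z - of_nat j * h)"

text \<open>Signed Stirling numbers of the first kind: the coefficients of \<open>(X | 1)\<^sub>n\<close>.
  The constant \<^const>\<open>stirling\<close> of the library is the unsigned version.\<close>

definition sstirling :: "nat \<Rightarrow> nat \<Rightarrow> complex" where
  "sstirling n k = coeff (gfall [:0, 1:] 1 n) k"

text \<open>The generalized Stirling numbers \<open>S(n, k; h, r)\<close>: the coordinates of the polynomial
  \<open>(z + r | h)\<^sub>n\<close> in the basis \<open>(z | -h)\<^sub>k\<close>. Well-definedness of the description is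
  \<open>gen_stirling_unique_ex\<close> below.\<close>

definition gen_stirling :: "nat \<Rightarrow> nat \<Rightarrow> complex \<Rightarrow> complex \<Rightarrow> complex" where
  "gen_stirling n k h r =
     (THE c. (\<forall>j>n. c j = 0) \<and>
             (\<forall>z. gfall (z + r) h n = (\<Sum>j=0..n. c j * gfall z (- h) j))) k"

lemma gfall_0 [simp]: "gfall z h 0 = 1"
  by (simp add: gfall_def)

lemma gfall_Suc: "gfall z h (Suc n) = gfall z h n * (z - of_nat n * h)"
  by (simp add: gfall_def)

lemma poly_gfall: "poly (gfall [:0, 1:] [:h:] n) z = gfall z h n"
  for z h :: complex
  by (induction n) (simp_all add: gfall_Suc of_nat_poly algebra_simps)

lemma degree_gfall:
  fixes h :: complex
  shows "degree (gfall [:0, 1:] [:h:] n) = n"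
    and coeff_gfall_top: "coeff (gfall [:0, 1:] [:h:] n) n = 1"
proof -
  have "degree (gfall [:0, 1:] [:h:] n) = n \<and> lead_coeff (gfall [:0, 1:] [:h:] n) = 1"
  proof (induction n)
    case (Suc n)
    have eq: "[:0, 1:] - of_nat n * [:h:] = [:- (of_nat n * h), 1:]"
      by (simp add: of_nat_poly)
    have nz: "gfall [:0, 1:] [:h:] n \<noteq> 0"
      using Suc by auto
    have "degree (gfall [:0, 1:] [:h:] (Suc n)) = Suc n"
      unfolding gfall_Suc eq using Suc nz by (subst degree_mult_eq) auto
    moreover have "lead_coeff (gfall [:0, 1:] [:h:] (Suc n)) = 1"
      unfolding gfall_Suc eq lead_coeff_mult using Suc by (metis lead_coeff_pCons(1) lead_coeff_1 mult_1 one_neq_zero one_pCons)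
    ultimately show ?case by blast
  qed simp
  then show "degree (gfall [:0, 1:] [:h:] n) = n" "coeff (gfall [:0, 1:] [:h:] n) n = 1"
    by metis+
qed

lemma gfall_independent:
  fixes h :: complex
  assumes "\<And>z. (\<Sum>j=0..n. c j * gfall z h j) = 0" and "k \<le> n"
  shows "c k = 0"
  using assms
proof (induction n arbitrary: k)
  case (Suc n)
  let ?g = "\<lambda>j. gfall [:0, 1:] [:h:] j"
  have "poly (\<Sum>j=0..Suc n. smult (c j) (?g j)) z = 0" for z
    using Suc.prems(1)[of z] by (simp add: poly_sum poly_gfall)
  then have "(\<Sum>j=0..Suc n. smult (c j) (?g j)) = 0"
    using poly_all_0_iff_0 by blast
  then have "(\<Sum>j=0..Suc n. coeff (smult (c j) (?g j)) (Suc n)) = 0"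
    by (metis coeff_0 coeff_sum)
  moreover have "coeff (?g j) (Suc n) = 0" if "j \<le> n" for j
    using that by (intro coeff_eq_0) (simp add: degree_gfall)
  ultimately have top: "c (Suc n) = 0"
    using coeff_gfall_top[of h "Suc n"] by simp
  then show ?case
    using Suc.IH[of k] Suc.prems by (cases "k = Suc n") auto
qed simp

lemma gen_stirling_ex:
  fixes h r :: complex
  shows "\<exists>c. (\<forall>j>n. c j = 0) \<and>
             (\<forall>z. gfall (z + r) h n = (\<Sum>j=0..n. c j * gfall z (- h) j))"
proof (induction n)
  case 0
  show ?case by (rule exI[of _ "\<lambda>j. if j = 0 then 1 else 0"]) simp
next
  case (Suc n)
  then obtain c where c0: "\<And>j. j > n \<Longrightarrow> c j = 0"
    and c: "\<And>z. gfall (z + r) h n = (\<Sum>j=0..n. c j * gfall z (- h) j)" by blast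
  define d where "d = (\<lambda>j. (if j = 0 then 0 else c (j - 1)) + c j * (r - of_nat n * h - of_nat j * h))"
  have "gfall (z + r) h (Suc n) = (\<Sum>j=0..Suc n. d j * gfall z (- h) j)" for z
  proof -
    have "gfall (z + r) h (Suc n)
        = (\<Sum>j=0..n. c j * gfall z (- h) j * (z + r - of_nat n * h))"
      by (simp add: gfall_Suc c sum_distrib_right)
    also have "\<dots> = (\<Sum>j=0..n. c j * gfall z (- h) (Suc j))
        + (\<Sum>j=0..n. c j * (r - of_nat n * h - of_nat j * h) * gfall z (- h) j)"
      unfolding sum.distrib[symmetric]
      by (intro sum.cong) (simp_all add: gfall_Suc algebra_simps)
    also have "(\<Sum>j=0..n. c j * gfall z (- h) (Suc j))
        = (\<Sum>j=0..Suc n. (if j = 0 then 0 else c (j - 1)) * gfall z (- h) j)"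
      by (subst sum.atLeast0_atMost_Suc_shift) simp
    also have "(\<Sum>j=0..n. c j * (r - of_nat n * h - of_nat j * h) * gfall z (- h) j)
        = (\<Sum>j=0..Suc n. c j * (r - of_nat n * h - of_nat j * h) * gfall z (- h) j)"
      using c0[of "Suc n"] by simp
    finally show ?thesis
      unfolding sum.distrib[symmetric] d_def by (simp only: distrib_right)
  qed
  moreover have "d j = 0" if "j > Suc n" for j
    using that by (simp add: d_def c0)
  ultimately show ?case by blast
qed

lemma gen_stirling_unique_ex:
  fixes h r :: complex
  shows "\<exists>!c. (\<forall>j>n. c j = 0) \<and>
             (\<forall>z. gfall (z + r) h n = (\<Sum>j=0..n. c j * gfall z (- h) j))"
proof (rule ex_ex1I[OF gen_stirling_ex])
  fix c d :: "nat \<Rightarrow> complex"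
  assume c: "(\<forall>j>n. c j = 0) \<and> (\<forall>z. gfall (z + r) h n = (\<Sum>j=0..n. c j * gfall z (- h) j))"
    and d: "(\<forall>j>n. d j = 0) \<and> (\<forall>z. gfall (z + r) h n = (\<Sum>j=0..n. d j * gfall z (- h) j))"
  have sub: "(\<Sum>j=0..n. (c j - d j) * gfall z (- h) j) = 0" for z
  proof -
    have "(\<Sum>j=0..n. c j * gfall z (- h) j) = (\<Sum>j=0..n. d j * gfall z (- h) j)"
      using c d by metis
    then show ?thesis by (simp add: left_diff_distrib sum_subtractf)
  qed
  show "c = d"
  proof
    fix k
    show "c k = d k"
      using gfall_independent[where c = "\<lambda>j. c j - d j", OF sub, of k] c d
      by (cases "k \<le> n") auto
  qed
qed

lemma gen_stirling_expansion:
  "gfall (z + r) h n = (\<Sum>k=0..n. gen_stirling n k h r * gfall z (- h) k)"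
  using theI'[OF gen_stirling_unique_ex[of n r h]] unfolding gen_stirling_def by blast

lemma gen_stirling_eqI:
  assumes "\<And>z. gfall (z + r) h n = (\<Sum>k=0..n. c k * gfall z (- h) k)" and "k \<le> n"
  shows "gen_stirling n k h r = c k"
proof -
  have "(\<Sum>j=0..n. (gen_stirling n j h r - c j) * gfall z (- h) j) = 0" for z
    using assms(1)[of z] gen_stirling_expansion[of z r h n]
    by (simp add: left_diff_distrib sum_subtractf)
  from gfall_independent[where c = "\<lambda>j. gen_stirling n j h r - c j", OF this assms(2)]
  show ?thesis by simp
qed

lemma sstirling_expansion:
  fixes z :: complex
  assumes "n \<ge> 1"
  shows "gfall z 1 n = (\<Sum>k=1..n. sstirling n k * z ^ k)"
proof -
  let ?g = "gfall [:0, 1:] [:1::complex:] n"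
  have deg: "degree ?g = n"
    using degree_gfall by blast
  obtain m where n: "n = Suc m"
    using assms by (cases n) auto
  have "poly ?g 0 = 0"
    unfolding poly_gfall n by (auto simp: gfall_def prod.lessThan_Suc_shift)
  then have c0: "coeff ?g 0 = 0"
    by (simp add: poly_0_coeff_0)
  have "gfall z 1 n = (\<Sum>k\<le>n. coeff ?g k * z ^ k)"
    by (metis deg poly_altdef poly_gfall)
  also have "\<dots> = (\<Sum>k=1..n. coeff ?g k * z ^ k)"
    by (rule sum.mono_neutral_right) (auto simp: c0 Suc_le_eq)
  finally show ?thesis
    by (simp add: sstirling_def one_pCons)
qed

lemma Stirling_expansion:
  fixes z :: complex
  assumes "n \<ge> 1"
  shows "z ^ n = (\<Sum>k=1..n. of_nat (Stirling n k) * gfall z 1 k)"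
proof -
  have "z ^ m = (\<Sum>k=0..m. of_nat (Stirling m k) * gfall z 1 k)" for m
  proof (induction m)
    case (Suc m)
    have "z ^ Suc m = (\<Sum>k=0..m. of_nat (Stirling m k) * (gfall z 1 k * z))"
      by (simp add: Suc sum_distrib_left mult_ac)
    also have "\<dots> = (\<Sum>k=0..m. of_nat (Stirling m k) * gfall z 1 (Suc k))
        + (\<Sum>k=0..m. of_nat k * of_nat (Stirling m k) * gfall z 1 k)"
      unfolding sum.distrib[symmetric]
      by (intro sum.cong) (simp_all add: gfall_Suc algebra_simps)
    also have "(\<Sum>k=0..m. of_nat k * of_nat (Stirling m k) * gfall z 1 k)
        = (\<Sum>k=0..Suc m. of_nat k * of_nat (Stirling m k) * gfall z 1 k)"
      by simp
    also have "\<dots> = (\<Sum>k=0..m. of_nat (Suc k) * of_nat (Stirling m (Suc k)) * gfall z 1 (Suc k))"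
      by (subst sum.atLeast0_atMost_Suc_shift) simp
    also have "(\<Sum>k=0..m. of_nat (Stirling m k) * gfall z 1 (Suc k)) + \<dots>
        = (\<Sum>k=0..m. of_nat (Stirling (Suc m) (Suc k)) * gfall z 1 (Suc k))"
      unfolding sum.distrib[symmetric]
      by (intro sum.cong) (simp_all add: algebra_simps)
    also have "\<dots> = (\<Sum>k=0..Suc m. of_nat (Stirling (Suc m) k) * gfall z 1 k)"
      by (subst sum.atLeast0_atMost_Suc_shift) simp
    finally show ?case .
  qed simp
  from this[of n] show ?thesis
    using assms by (cases n) (simp_all add: sum.atLeast_Suc_atMost)
qed

end

theory Submission
  imports Defs
begin

text \<open>Put \<open>r = \<sigma> / \<alpha>\<close>. The linear map \<open>\<phi>\<close> sending \<open>(z | -\<beta>)\<^sub>k\<close> to \<open>(z | \<alpha> - \<beta>)\<^sub>k\<close> sends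
  \<open>(z - r | \<beta>)\<^sub>n\<close> to \<open>p\<^sub>n\<close>: in coordinates, the recurrence of \<open>p\<^sub>n\<close> amounts to
  \<open>(k - n) S(n,k;\<beta>,-r) = n (r + \<beta> (n - 1)) S(n-1,k;\<beta>,-r)\<close>.
  Expanding \<open>(z | -\<beta>)\<^sub>k\<close> in the basis \<open>(z - r | \<beta>)\<^sub>i\<close> and applying \<open>\<phi>\<close> gives the inverse relation
  \<open>(z | \<alpha> - \<beta>)\<^sub>k = \<Sum>\<^sub>i S(k,i;-\<beta>,r) p\<^sub>i\<close>. The ordinary Stirling numbers convert between
  \<open>(z | \<alpha> - \<beta>)\<^sub>k\<close> and \<open>z\<^sup>n\<close>.\<close>

section \<open>Classical Stirling expansions for an arbitrary step \<open>d\<close>\<close>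

lemma gfall_scale: "gfall (d * z) d n = d ^ n * gfall z 1 n"
  by (induction n) (simp_all add: gfall_Suc algebra_simps)

lemma gfall_step_0: "gfall z 0 n = z ^ n"
  by (simp add: gfall_def)

lemma gfall_zero_left: "n \<ge> 1 \<Longrightarrow> gfall 0 h n = 0"
  by (induction n rule: nat_induct_at_least) (simp_all add: gfall_Suc gfall_def)

text \<open>With \<open>0 ^ 0 = 1\<close> only the diagonal term survives; this settles step
  \<open>d = 0\<close>, that is \<open>\<alpha> = \<beta>\<close>.\<close>

lemma sum_pow_zero_last:
  fixes f :: "nat \<Rightarrow> 'a::comm_ring_1"
  assumes "n \<ge> 1"
  shows "(\<Sum>k=1..n. 0 ^ (n - k) * f k) = f n"
proof -
  have "(\<Sum>k=1..n. 0 ^ (n - k) * f k) = (\<Sum>k=1..n. if k = n then f k else 0)"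
    by (intro sum.cong) (auto simp: power_0_left)
  then show ?thesis using assms by simp
qed

text \<open>Substituting \<open>z = d * x\<close> reduces nonzero \<open>d\<close> to step 1, and
  the rescaling leaves the factor \<open>d ^ (n - k)\<close>.\<close>

lemma power_eq_sum_Stirling_gfall:
  fixes d z :: complex
  assumes "n \<ge> 1"
  shows "z ^ n = (\<Sum>k=1..n. d ^ (n - k) * of_nat (Stirling n k) * gfall z d k)"
proof (cases "d = 0")
  case True
  then show ?thesis
    using sum_pow_zero_last[OF assms, of "\<lambda>k. of_nat (Stirling n k) * z ^ k"]
    by (simp add: gfall_step_0 mult.assoc)
next
  case False
  define x where "x = z / d"
  have z: "z = d * x" using False by (simp add: x_def)
  have "z ^ n = (\<Sum>k=1..n. d ^ n * (of_nat (Stirling n k) * gfall x 1 k))"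
    using Stirling_expansion[OF assms, of x] by (simp add: z power_mult_distrib sum_distrib_left)
  also have "\<dots> = (\<Sum>k=1..n. d ^ (n - k) * of_nat (Stirling n k) * gfall z d k)"
  proof (intro sum.cong refl)
    fix k assume "k \<in> {1..n}"
    then have "d ^ n = d ^ (n - k) * d ^ k" by (simp flip: power_add)
    then show "d ^ n * (of_nat (Stirling n k) * gfall x 1 k)
        = d ^ (n - k) * of_nat (Stirling n k) * gfall z d k"
      by (simp add: z gfall_scale)
  qed
  finally show ?thesis .
qed

lemma sstirling_self: "sstirling n n = 1"
  using coeff_gfall_top[of 1 n] by (simp add: sstirling_def one_pCons)

lemma gfall_eq_sum_sstirling_power:
  fixes d z :: complex
  assumes "n \<ge> 1"
  shows "gfall z d n = (\<Sum>k=1..n. d ^ (n - k) * sstirling n k * z ^ k)"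
proof (cases "d = 0")
  case True
  then show ?thesis
    using sum_pow_zero_last[OF assms, of "\<lambda>k. sstirling n k * z ^ k"]
    by (simp add: gfall_step_0 mult.assoc sstirling_self)
next
  case False
  define x where "x = z / d"
  have z: "z = d * x" using False by (simp add: x_def)
  have "gfall z d n = (\<Sum>k=1..n. d ^ n * (sstirling n k * x ^ k))"
    using sstirling_expansion[OF assms, of x] by (simp add: z gfall_scale sum_distrib_left)
  also have "\<dots> = (\<Sum>k=1..n. d ^ (n - k) * sstirling n k * z ^ k)"
  proof (intro sum.cong refl)
    fix k assume "k \<in> {1..n}"
    then have "d ^ n = d ^ (n - k) * d ^ k" by (simp flip: power_add)
    then show "d ^ n * (sstirling n k * x ^ k) = d ^ (n - k) * sstirling n k * z ^ k"
      by (simp add: z power_mult_distrib)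
  qed
  finally show ?thesis .
qed

section \<open>Recurrences for the generalized Stirling numbers\<close>

lemma gen_stirling_gt: "j > n \<Longrightarrow> gen_stirling n j h r = 0"
  using theI'[OF gen_stirling_unique_ex[of n r h]] unfolding gen_stirling_def by blast

lemma gen_stirling_0_0: "gen_stirling 0 0 h r = 1"
  using gen_stirling_expansion[of 0 r h 0] by simp

text \<open>At \<open>z = 0\<close> only the term with \<open>k = 0\<close> survives. This entry
  supplies the terms outside the double sums of the theorem.\<close>

lemma gen_stirling_zero_right: "gen_stirling n 0 h r = gfall r h n"
proof -
  have "gfall r h n = (\<Sum>k=0..n. gen_stirling n k h r * gfall 0 (- h) k)"
    using gen_stirling_expansion[of 0 r h n] by simp
  also have "\<dots> = gen_stirling n 0 h r"
    by (subst sum.atLeast_Suc_atMost) (simp_all add: gfall_zero_left)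
  finally show ?thesis by simp
qed

text \<open>The new factor splits as
  \<open>z + r - n * h = (z + k * h) + (r - n * h - k * h)\<close>; the first summand raises the
  index of \<open>gfall z (- h) k\<close>, the second is a scalar.\<close>

lemma gen_stirling_Suc:
  "gen_stirling (Suc n) k h r = (if k = 0 then 0 else gen_stirling n (k - 1) h r)
     + (r - of_nat n * h - of_nat k * h) * gen_stirling n k h r"
proof (cases "k \<le> Suc n")
  case True
  let ?c = "\<lambda>j. gen_stirling n j h r"
  have "gfall (z + r) h (Suc n) = (\<Sum>k=0..Suc n. ((if k = 0 then 0 else ?c (k - 1))
     + (r - of_nat n * h - of_nat k * h) * ?c k) * gfall z (- h) k)" for z
  proof -
    have "gfall (z + r) h (Suc n)
        = (\<Sum>j=0..n. ?c j * gfall z (- h) j * (z + r - of_nat n * h))"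
      by (simp add: gfall_Suc gen_stirling_expansion sum_distrib_right)
    also have "\<dots> = (\<Sum>j=0..n. ?c j * gfall z (- h) (Suc j))
        + (\<Sum>j=0..n. (r - of_nat n * h - of_nat j * h) * ?c j * gfall z (- h) j)"
      unfolding sum.distrib[symmetric]
      by (intro sum.cong) (simp_all add: gfall_Suc algebra_simps)
    also have "(\<Sum>j=0..n. ?c j * gfall z (- h) (Suc j))
        = (\<Sum>j=0..Suc n. (if j = 0 then 0 else ?c (j - 1)) * gfall z (- h) j)"
      by (subst sum.atLeast0_atMost_Suc_shift) simp
    also have "(\<Sum>j=0..n. (r - of_nat n * h - of_nat j * h) * ?c j * gfall z (- h) j)
        = (\<Sum>j=0..Suc n. (r - of_nat n * h - of_nat j * h) * ?c j * gfall z (- h) j)"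
      by (simp add: gen_stirling_gt)
    finally show ?thesis
      unfolding sum.distrib[symmetric] by (simp only: distrib_right)
  qed
  from gen_stirling_eqI[OF this True] show ?thesis .
qed (simp add: gen_stirling_gt)

text \<open>For \<open>k \<le> n\<close> this is the ratio of consecutive entries, at fixed
  \<open>k\<close>, of binomial(n,k) times the product of \<open>r - j * h\<close> over
  \<open>k \<le> j < n\<close>. The induction needs only the triangular recurrence.\<close>

lemma gen_stirling_first_order_rec:
  "(of_nat k - of_nat (Suc n)) * gen_stirling (Suc n) k h r
     = of_nat (Suc n) * (of_nat n * h - r) * gen_stirling n k h r"
proof (induction n arbitrary: k)
  case 0
  consider "k = 0" | "k = 1" | "k > 1" by linarith
  then show ?case
    by cases (simp_all add: gen_stirling_Suc gen_stirling_gt gen_stirling_0_0)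
next
  case (Suc n)
  define a where "a = of_nat n * h - r"
  define N K :: complex where "N = of_nat (Suc n)" and "K = of_nat k"
  define c0 c1 where "c0 = gen_stirling n k h r" and "c1 = gen_stirling (Suc n) k h r"
  define b0 b1 where "b0 = (if k = 0 then 0 else gen_stirling n (k - 1) h r)"
    and "b1 = (if k = 0 then 0 else gen_stirling (Suc n) (k - 1) h r)"
  have A: "(K - N) * c1 = N * a * c0"
    using Suc.IH[of k] by (simp add: a_def N_def K_def c0_def c1_def)
  \<comment> \<open>For \<open>k = 0\<close> both sides vanish, so the truncated
    \<open>k - 1\<close> does no harm.\<close>
  have B: "(K - 1 - N) * b1 = N * a * b0"
    using Suc.IH[of "k - 1"] by (cases k) (simp_all add: a_def N_def K_def b0_def b1_def)
  have C: "c1 = b0 - (a + K * h) * c0"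
    by (simp add: gen_stirling_Suc c1_def c0_def b0_def a_def K_def algebra_simps)
  have D: "gen_stirling (Suc (Suc n)) k h r = b1 - (a + h + K * h) * c1"
    by (simp add: gen_stirling_Suc[of "Suc n"] c1_def b1_def a_def K_def algebra_simps)
  \<comment> \<open>\<open>B\<close> eliminates \<open>b1\<close> and \<open>C\<close> eliminates
    \<open>b0\<close>; then \<open>A\<close> trades \<open>c0\<close> for \<open>c1\<close>, leaving
    a multiple of \<open>c1\<close>.\<close>
  have "(K - 1 - N) * (b1 - (a + h + K * h) * c1)
      = N * a * (c1 + (a + K * h) * c0) - (a + h + K * h) * ((K - N) * c1 - c1)"
    using B C by (simp add: algebra_simps)
  also have "\<dots> = N * a * c1 + (a + K * h) * ((K - N) * c1) - (a + h + K * h) * ((K - N) * c1 - c1)"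
    unfolding A by (simp add: algebra_simps)
  also have "\<dots> = (N + 1) * (a + h) * c1"
    by (simp add: algebra_simps)
  finally show ?case
    unfolding D by (simp add: N_def K_def a_def c1_def algebra_simps)
qed

section \<open>Inverting the change of basis, and the polynomials \<open>p\<close>\<close>

lemma sum_triangle_swap:
  fixes f :: "nat \<Rightarrow> nat \<Rightarrow> 'a::comm_monoid_add"
  shows "(\<Sum>k=1..n. \<Sum>i=1..k. f k i) = (\<Sum>i=1..n. \<Sum>k=i..n. f k i)"
  by (induction n) (simp_all add: sum.distrib)

text \<open>Expanding \<open>gfall w (- h) k\<close> in the \<open>gfall (w - r) h i\<close> and
  then back must return the same basis element; independence lets coefficients be compared.\<close>

lemma gen_stirling_inverse:
  assumes "j \<le> k"
  shows "(\<Sum>i=0..k. gen_stirling k i (- h) r * gen_stirling i j h (- r)) = (if j = k then 1 else 0)"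
proof -
  let ?e = "\<lambda>j. \<Sum>i=0..k. gen_stirling k i (- h) r * gen_stirling i j h (- r)"
  have "(\<Sum>j=0..k. (?e j - (if j = k then 1 else 0)) * gfall w (- h) j) = 0" for w
  proof -
    have "gfall w (- h) k = (\<Sum>i=0..k. gen_stirling k i (- h) r * gfall (w + - r) h i)"
      using gen_stirling_expansion[of "w - r" r "- h" k] by simp
    also have "\<dots> = (\<Sum>i=0..k. \<Sum>j=0..k.
        gen_stirling k i (- h) r * gen_stirling i j h (- r) * gfall w (- h) j)"
    proof (intro sum.cong refl)
      fix i assume i: "i \<in> {0..k}"
      have "gfall (w + - r) h i = (\<Sum>j=0..k. gen_stirling i j h (- r) * gfall w (- h) j)"
        unfolding gen_stirling_expansion
        using i by (intro sum.mono_neutral_left) (auto simp: gen_stirling_gt)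
      then show "gen_stirling k i (- h) r * gfall (w + - r) h i
        = (\<Sum>j=0..k. gen_stirling k i (- h) r * gen_stirling i j h (- r) * gfall w (- h) j)"
        by (simp add: sum_distrib_left mult.assoc)
    qed
    also have "\<dots> = (\<Sum>j=0..k. ?e j * gfall w (- h) j)"
      by (subst sum.swap) (simp add: sum_distrib_right)
    finally show ?thesis
      by (simp add: left_diff_distrib sum_subtractf if_distrib[of "\<lambda>x. x * _"] cong: if_cong)
  qed
  from gfall_independent[OF this assms] show ?thesis by simp
qed

text \<open>The recurrence determines \<open>q\<close> from \<open>q 0\<close>, so it suffices that
  the right-hand side satisfies it too. Here \<open>z\<close> is fixed and \<open>q n\<close> stands
  for the value of \<open>p n\<close> at \<open>z\<close>.\<close>

lemma eq_sum_gen_stirling_gfall: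
  fixes q :: "nat \<Rightarrow> complex"
  assumes q0: "q 0 = 1"
    and rec: "\<And>n. z * q n = q (n + 1) + ((\<alpha> + \<beta>) * of_nat n + r) * q n
      + (\<alpha> * r * of_nat n + \<alpha> * \<beta> * of_nat n * (of_nat n - 1)) * q (n - 1)"
  shows "q n = (\<Sum>k=0..n. gen_stirling n k \<beta> (- r) * gfall z (\<alpha> - \<beta>) k)"
proof -
  define c where "c = (\<lambda>n k. gen_stirling n k \<beta> (- r))"
  define g where "g = gfall z (\<alpha> - \<beta>)"
  define s where "s = (\<lambda>n. \<Sum>k=0..n. c n k * g k)"
  have c_gt: "c n k = 0" if "k > n" for n k
    using that by (simp add: c_def gen_stirling_gt)
  \<comment> \<open>Zero padding brings \<open>s (n - 1)\<close>, \<open>s n\<close> and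
    \<open>s (Suc n)\<close> to a common range.\<close>
  have s_ext: "s n = (\<Sum>k=0..m. c n k * g k)" if "n \<le> m" for n m
    unfolding s_def using that by (intro sum.mono_neutral_left) (auto simp: c_gt)
  have s_rec: "z * s n = s (Suc n) + ((\<alpha> + \<beta>) * of_nat n + r) * s n
      + (\<alpha> * r * of_nat n + \<alpha> * \<beta> * of_nat n * (of_nat n - 1)) * s (n - 1)" for n
  proof -
    \<comment> \<open>The left side is the coefficient of \<open>g k\<close> in
      \<open>z * s n\<close>, because
      \<open>z * g k = g (Suc k) + k * (\<alpha> - \<beta>) * g k\<close>.\<close>
    have coeff: "(if k = 0 then 0 else c n (k - 1)) + of_nat k * (\<alpha> - \<beta>) * c n k
        = c (Suc n) k + ((\<alpha> + \<beta>) * of_nat n + r) * c n k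
          + (\<alpha> * r * of_nat n + \<alpha> * \<beta> * of_nat n * (of_nat n - 1)) * c (n - 1) k" for k
    proof -
      have "(of_nat k - of_nat n) * c n k = of_nat n * ((of_nat n - 1) * \<beta> + r) * c (n - 1) k"
      proof (cases n)
        case 0
        then show ?thesis by (cases k) (simp_all add: c_gt)
      next
        case (Suc m)
        then show ?thesis
          using gen_stirling_first_order_rec[of k m \<beta> "- r"] by (simp add: c_def)
      qed
      \<comment> \<open>Multiplication by \<open>\<alpha>\<close> produces exactly the coefficient
        of the lowest term in the recurrence.\<close>
      then have "\<alpha> * ((of_nat k - of_nat n) * c n k)
          = (\<alpha> * r * of_nat n + \<alpha> * \<beta> * of_nat n * (of_nat n - 1)) * c (n - 1) k"
        by (simp only:) (simp add: algebra_simps)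
      moreover have "c (Suc n) k = (if k = 0 then 0 else c n (k - 1))
          + (- r - of_nat n * \<beta> - of_nat k * \<beta>) * c n k"
        unfolding c_def by (rule gen_stirling_Suc)
      ultimately show ?thesis by (simp only:) (simp add: algebra_simps)
    qed
    have "z * s n = (\<Sum>k=0..n. c n k * g (Suc k)) + (\<Sum>k=0..n. of_nat k * (\<alpha> - \<beta>) * c n k * g k)"
      unfolding s_def sum_distrib_left sum.distrib[symmetric] g_def
      by (intro sum.cong) (simp_all add: gfall_Suc algebra_simps)
    also have "(\<Sum>k=0..n. c n k * g (Suc k))
        = (\<Sum>k=0..Suc n. (if k = 0 then 0 else c n (k - 1)) * g k)"
      by (subst sum.atLeast0_atMost_Suc_shift) simp
    also have "(\<Sum>k=0..n. of_nat k * (\<alpha> - \<beta>) * c n k * g k)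
        = (\<Sum>k=0..Suc n. of_nat k * (\<alpha> - \<beta>) * c n k * g k)"
      by (simp add: c_gt)
    also have "(\<Sum>k=0..Suc n. (if k = 0 then 0 else c n (k - 1)) * g k) + \<dots>
        = (\<Sum>k=0..Suc n. (c (Suc n) k + ((\<alpha> + \<beta>) * of_nat n + r) * c n k
          + (\<alpha> * r * of_nat n + \<alpha> * \<beta> * of_nat n * (of_nat n - 1)) * c (n - 1) k) * g k)"
      by (simp only: coeff flip: sum.distrib distrib_right)
    also have "\<dots> = s (Suc n) + ((\<alpha> + \<beta>) * of_nat n + r) * s n
      + (\<alpha> * r * of_nat n + \<alpha> * \<beta> * of_nat n * (of_nat n - 1)) * s (n - 1)"
      using s_ext[of "Suc n" "Suc n"] s_ext[of n "Suc n"] s_ext[of "n - 1" "Suc n"]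
      by (simp only: distrib_right sum.distrib sum_distrib_left mult.assoc)
    finally show ?thesis .
  qed
  \<comment> \<open>Two consecutive values are carried because the recurrence has three terms; at
    \<open>n = 0\<close> the index \<open>n - 1\<close> is 0, but its coefficient vanishes.\<close>
  have "q n = s n \<and> q (Suc n) = s (Suc n)" for n
  proof (induction n)
    case 0
    have "q 0 = s 0" by (simp add: q0 s_def c_def g_def gen_stirling_0_0)
    then show ?case using rec[of 0] s_rec[of 0] by simp
  next
    case (Suc n)
    then show ?case using rec[of "Suc n"] s_rec[of "Suc n"] by simp
  qed
  then show ?thesis by (simp add: s_def c_def g_def)
qed

theorem theoremA8:
  fixes \<sigma> :: real and \<alpha> \<beta> lam eta :: complex and p :: "nat \<Rightarrow> complex poly"
  assumes "\<sigma> > 0" and "\<alpha> \<noteq> 0" and "\<beta> \<noteq> 0"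
    and "lam = \<alpha> + \<beta>" and "eta = \<alpha> * \<beta>"
    and monic: "\<And>n. degree (p n) = n \<and> lead_coeff (p n) = 1"
    and p0: "p 0 = 1"
    and rec: "\<And>n z. z * poly (p n) z =
        poly (p (n + 1)) z
        + (lam * of_nat n + of_real \<sigma> / \<alpha>) * poly (p n) z
        + (of_real \<sigma> * of_nat n + eta * of_nat n * (of_nat n - 1)) * poly (p (n - 1)) z"
  shows "\<forall>n\<ge>1. \<forall>z.
      z ^ n =
        (\<Sum>k=1..n. (\<alpha> - \<beta>) ^ (n - k) * of_nat (Stirling n k) * gfall (of_real \<sigma> / \<alpha>) (- \<beta>) k)
        + (\<Sum>i=1..n.
            (\<Sum>k=i..n. (\<alpha> - \<beta>) ^ (n - k) * of_nat (Stirling n k)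
                       * gen_stirling k i (- \<beta>) (of_real \<sigma> / \<alpha>)) * poly (p i) z)
      \<and> poly (p n) z =
        gfall (- (of_real \<sigma> / \<alpha>)) \<beta> n
        + (\<Sum>i=1..n.
            (\<Sum>k=i..n. gen_stirling n k \<beta> (- (of_real \<sigma> / \<alpha>))
                       * (\<alpha> - \<beta>) ^ (k - i) * sstirling k i) * z ^ i)"
proof (intro allI impI)
  fix n :: nat and z :: complex
  assume n: "n \<ge> 1"
  define r where "r = of_real \<sigma> / \<alpha>"
  define d where "d = \<alpha> - \<beta>"
  \<comment> \<open>Written as \<open>\<alpha> * r\<close>, the parameter \<open>\<sigma>\<close>
    fits the recurrence of \<open>eq_sum_gen_stirling_gfall\<close>.\<close>
  have \<sigma>: "of_real \<sigma> = \<alpha> * r"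
    using \<open>\<alpha> \<noteq> 0\<close> by (simp add: r_def)
  have p_eq: "poly (p m) z = (\<Sum>k=0..m. gen_stirling m k \<beta> (- r) * gfall z d k)" for m
    unfolding d_def
  proof (rule eq_sum_gen_stirling_gfall)
    show "z * poly (p m) z = poly (p (m + 1)) z + ((\<alpha> + \<beta>) * of_nat m + r) * poly (p m) z
      + (\<alpha> * r * of_nat m + \<alpha> * \<beta> * of_nat m * (of_nat m - 1)) * poly (p (m - 1)) z" for m
      using rec[of z m] \<open>\<alpha> \<noteq> 0\<close> unfolding assms(4,5) \<sigma> by simp
  qed (simp add: p0)
  \<comment> \<open>Inserting \<open>p_eq\<close> on the right leaves the product of the two inverse
    coefficient matrices.\<close>
  have gfall_eq: "gfall z d k = (\<Sum>i=0..k. gen_stirling k i (- \<beta>) r * poly (p i) z)" for k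
  proof -
    have "(\<Sum>i=0..k. gen_stirling k i (- \<beta>) r * poly (p i) z)
        = (\<Sum>i=0..k. \<Sum>j=0..k. gen_stirling k i (- \<beta>) r * gen_stirling i j \<beta> (- r) * gfall z d j)"
    proof (intro sum.cong refl)
      fix i assume i: "i \<in> {0..k}"
      have "poly (p i) z = (\<Sum>j=0..k. gen_stirling i j \<beta> (- r) * gfall z d j)"
        unfolding p_eq using i by (intro sum.mono_neutral_left) (auto simp: gen_stirling_gt)
      then show "gen_stirling k i (- \<beta>) r * poly (p i) z
        = (\<Sum>j=0..k. gen_stirling k i (- \<beta>) r * gen_stirling i j \<beta> (- r) * gfall z d j)"
        by (simp add: sum_distrib_left mult.assoc)
    qed
    also have "\<dots> = (\<Sum>j=0..k. (\<Sum>i=0..k. gen_stirling k i (- \<beta>) r * gen_stirling i j \<beta> (- r))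
        * gfall z d j)"
      by (subst sum.swap) (simp add: sum_distrib_right)
    also have "\<dots> = (\<Sum>j=0..k. if j = k then gfall z d j else 0)"
      by (intro sum.cong) (simp_all add: gen_stirling_inverse)
    finally show ?thesis by simp
  qed
  \<comment> \<open>The term \<open>i = 0\<close> is split off, using
    \<open>p 0 = 1\<close>.\<close>
  have gfall_eq': "gfall z d k
      = gfall r (- \<beta>) k + (\<Sum>i=1..k. gen_stirling k i (- \<beta>) r * poly (p i) z)" for k
    unfolding gfall_eq by (subst sum.atLeast_Suc_atMost) (simp_all add: gen_stirling_zero_right p0)
  define T where "T = (\<lambda>k. d ^ (n - k) * of_nat (Stirling n k))"
  have "z ^ n = (\<Sum>k=1..n. T k * gfall z d k)"
    using power_eq_sum_Stirling_gfall[OF n] by (simp add: T_def)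
  also have "\<dots> = (\<Sum>k=1..n. T k * gfall r (- \<beta>) k)
      + (\<Sum>k=1..n. \<Sum>i=1..k. T k * gen_stirling k i (- \<beta>) r * poly (p i) z)"
    unfolding gfall_eq' by (simp add: distrib_left sum.distrib sum_distrib_left mult.assoc)
  also have "(\<Sum>k=1..n. \<Sum>i=1..k. T k * gen_stirling k i (- \<beta>) r * poly (p i) z)
      = (\<Sum>i=1..n. (\<Sum>k=i..n. T k * gen_stirling k i (- \<beta>) r) * poly (p i) z)"
    by (subst sum_triangle_swap) (simp add: sum_distrib_right)
  finally have first: "z ^ n = (\<Sum>k=1..n. T k * gfall r (- \<beta>) k)
      + (\<Sum>i=1..n. (\<Sum>k=i..n. T k * gen_stirling k i (- \<beta>) r) * poly (p i) z)" .
  have "poly (p n) z = gfall (- r) \<beta> n + (\<Sum>k=1..n. gen_stirling n k \<beta> (- r) * gfall z d k)"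
    unfolding p_eq by (subst sum.atLeast_Suc_atMost) (simp_all add: gen_stirling_zero_right)
  also have "(\<Sum>k=1..n. gen_stirling n k \<beta> (- r) * gfall z d k)
      = (\<Sum>k=1..n. \<Sum>i=1..k. gen_stirling n k \<beta> (- r) * d ^ (k - i) * sstirling k i * z ^ i)"
    by (intro sum.cong refl)
      (simp add: gfall_eq_sum_sstirling_power sum_distrib_left mult.assoc)
  also have "\<dots> = (\<Sum>i=1..n. (\<Sum>k=i..n. gen_stirling n k \<beta> (- r) * d ^ (k - i) * sstirling k i) * z ^ i)"
    by (subst sum_triangle_swap) (simp add: sum_distrib_right)
  finally show "z ^ n =
        (\<Sum>k=1..n. (\<alpha> - \<beta>) ^ (n - k) * of_nat (Stirling n k) * gfall (of_real \<sigma> / \<alpha>) (- \<beta>) k)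
        + (\<Sum>i=1..n.
            (\<Sum>k=i..n. (\<alpha> - \<beta>) ^ (n - k) * of_nat (Stirling n k)
                       * gen_stirling k i (- \<beta>) (of_real \<sigma> / \<alpha>)) * poly (p i) z)
      \<and> poly (p n) z =
        gfall (- (of_real \<sigma> / \<alpha>)) \<beta> n
        + (\<Sum>i=1..n.
            (\<Sum>k=i..n. gen_stirling n k \<beta> (- (of_real \<sigma> / \<alpha>))
                       * (\<alpha> - \<beta>) ^ (k - i) * sstirling k i) * z ^ i)"
    using first unfolding T_def d_def r_def by (rule conjI[rotated])
qed

end
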